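(* For any $x=(x_c)_{c\in\mathcal I}\in\mathcal H$ the projection of $x$ on $\Omega_0=\{(E_c\cdot w)_{c\in\mathcal I}\in\mathcal H: w\in\mathbb C^{n\times n}\}$ is unique and given by $$P_{\Omega_0}(x)=(E_c\cdot z)_{c\in\mathcal I}\quad\text{with}\quad z=\frac12\sum_{c\in\mathcal I}(E_c\cdot x_c).$$
   Context: Let $n\ge1$ be an integer. All products and equalities of $n\times n$ arrays are elementwise; $w[\xi]$ is the entry of $w$ at index $\xi=(\xi_1,\xi_2)$, $1\le\xi_1,\xi_2\le n$. Let $\mathcal I=\{XX,XY,XZ,YX,YY,YZ\}$ and $\mathcal H=(\mathbb C^{n\times n})^6$, with elements $x=(x_c)_{c\in\mathcal I}$, with Frobenius norm $\|x\|^2=\sum_{c\in\mathcal I}\sum_\xi|x_c[\xi]|^2$. For $\Omega\subset\mathcal H$, $P_\Omega(x)=\{w\in\Omega:\|x-w\|=\inf_{v\in\Omega}\|x-v\|\}$; when it is a singleton $\{w\}$ one writes $P_\Omega(x)=w$. The matrices $E_c$: for every index $\xi$ (sampling point of the lens aperture) let $(k_X,k_Y,k_Z)=(k_X[\xi],k_Y[\xi],k_Z[\xi])\in\mathbb R^3$ be a unit vector (the unit wave vector) with $1+k_Z\neq0$. The real $n\times n$ matrices $E_c$ are given entrywise by $E_{XX}=1-\frac{k_X^2}{1+k_Z}$, $E_{XY}=E_{YX}=-\frac{k_Xk_Y}{1+k_Z}$, $E_{YY}=1-\frac{k_Y^2}{1+k_Z}$, $E_{XZ}=-k_X$, $E_{YZ}=-k_Y$;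 they satisfy $\sum_{c\in\mathcal I}E_c^2=2$ in every entry. *)

theory Defs
  imports "HOL-Analysis.Analysis"
begin

datatype component = XX | XY | XZ | YX | YY | YZ

lemma UNIV_component: "(UNIV :: component set) = {XX, XY, XZ, YX, YY, YZ}"
  using component.exhaust by blast

instance component :: finite
  by standard (simp add: UNIV_component)

text \<open>The index type \<open>'n\<close> stands for \<open>{1..n}\<close> with \<open>n = CARD('n) \<ge> 1\<close>; the entry of \<open>w\<close> at
  \<open>\<xi> = (i, j)\<close> is \<open>w $ i $ j\<close>.\<close>

type_synonym 'n field6 = "((complex ^ 'n) ^ 'n) ^ component"

text \<open>The library norm on \<open>'n field6\<close>, an iterated \<open>L2\<close>-norm, is the Frobenius norm.\<close>

lemma norm_field6:
  fixes x :: "('n::finite) field6"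
  shows "(norm x)\<^sup>2 = (\<Sum>c\<in>UNIV. \<Sum>i\<in>UNIV. \<Sum>j\<in>UNIV. (cmod (x $ c $ i $ j))\<^sup>2)"
  by (simp add: norm_vec_def L2_set_def sum_nonneg)

text \<open>Entrywise product of a real with a complex array. (The type-class product \<open>*\<close> on vectors
  would need both arrays to have the same entry type.)\<close>

definition emult :: "real ^ 'n ^ 'n \<Rightarrow> complex ^ 'n ^ 'n \<Rightarrow> complex ^ 'n ^ 'n"
  (infixl "\<odot>" 70) where
  "A \<odot> w = (\<chi> i j. complex_of_real (A $ i $ j) * w $ i $ j)"

text \<open>Each \<open>(kX $ i $ j, kY $ i $ j, kZ $ i $ j)\<close> is the wave vector at the point \<open>(i, j)\<close> of the
  aperture.\<close>

definition Emat ::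
  "real ^ 'n ^ 'n \<Rightarrow> real ^ 'n ^ 'n \<Rightarrow> real ^ 'n ^ 'n \<Rightarrow> component \<Rightarrow> real ^ 'n ^ 'n" where
  "Emat kX kY kZ c = (\<chi> i j. case c of
      XX \<Rightarrow> 1 - (kX $ i $ j)\<^sup>2 / (1 + kZ $ i $ j)
    | XY \<Rightarrow> - (kX $ i $ j * kY $ i $ j) / (1 + kZ $ i $ j)
    | XZ \<Rightarrow> - (kX $ i $ j)
    | YX \<Rightarrow> - (kX $ i $ j * kY $ i $ j) / (1 + kZ $ i $ j)
    | YY \<Rightarrow> 1 - (kY $ i $ j)\<^sup>2 / (1 + kZ $ i $ j)
    | YZ \<Rightarrow> - (kY $ i $ j))"

definition proj_set :: "'a::real_normed_vector set \<Rightarrow> 'a \<Rightarrow> 'a set" where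
  "proj_set \<Omega> x = {w \<in> \<Omega>. norm (x - w) = (INF v\<in>\<Omega>. norm (x - v))}"

definition Omega0 ::
  "real ^ 'n ^ 'n \<Rightarrow> real ^ 'n ^ 'n \<Rightarrow> real ^ 'n ^ 'n \<Rightarrow> 'n field6 set" where
  "Omega0 kX kY kZ = {\<chi> c. Emat kX kY kZ c \<odot> w | w. True}"

end

theory Submission
  imports Defs
begin

text \<open>Write \<open>T w = (E\<^sub>c \<odot> w)\<^sub>c\<close>, so that \<open>\<Omega>\<^sub>0\<close> is the range of the linear map \<open>T\<close>. Entrywise
  multiplication by a real array is self-adjoint, hence \<open>T\<close> has the adjoint
  \<open>T\<^sup>* y = (\<Sum>c. E\<^sub>c \<odot> y\<^sub>c)\<close> (\<open>inner_emult_tuple\<close>), and the identity \<open>(\<Sum>c. E\<^sub>c\<^sup>2) = 2\<close>, valid for unit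
  wave vectors (\<open>sum_Emat_squares\<close>), says that \<open>T\<^sup>* (T w) = 2 w\<close>. So \<open>T\<close> is \<open>\<surd>2\<close> times an isometry,
  and the normal equation \<open>T\<^sup>* (x - T z) = 0\<close> of the least-squares problem is solved by
  \<open>z = T\<^sup>* x / 2\<close>. Then \<open>x - T z\<close> is orthogonal to the range of \<open>T\<close>, and by Pythagoras \<open>T z\<close> is
  the only nearest point (\<open>proj_set_eq_singleton_orthogonal\<close>).\<close>

text \<open>Orthogonality gives \<open>\<parallel>x - v\<parallel>\<^sup>2 = \<parallel>x - p\<parallel>\<^sup>2 + \<parallel>p - v\<parallel>\<^sup>2\<close> for every \<open>v \<in> \<Omega>\<close>: the distance is
  smallest at \<open>v = p\<close> and strictly larger elsewhere.\<close>

lemma proj_set_eq_singleton_orthogonal: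
  fixes x p :: "'a::real_inner"
  assumes p: "p \<in> \<Omega>" and orth: "\<And>v. v \<in> \<Omega> \<Longrightarrow> orthogonal (x - p) (p - v)"
  shows "proj_set \<Omega> x = {p}"
proof -
  have pyth: "(norm (x - v))\<^sup>2 = (norm (x - p))\<^sup>2 + (norm (p - v))\<^sup>2" if "v \<in> \<Omega>" for v
    using norm_add_Pythagorean[OF orth[OF that]] by simp
  have le: "norm (x - p) \<le> norm (x - v)" if "v \<in> \<Omega>" for v
    by (rule power2_le_imp_le) (simp_all add: pyth[OF that])
  have inf: "(INF v\<in>\<Omega>. norm (x - v)) = norm (x - p)"
    using p le by (intro cInf_eq_minimum) auto
  have "v = p" if "v \<in> \<Omega>" "norm (x - v) = norm (x - p)" for v
    using pyth[OF that(1)] that(2) by simp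
  then show ?thesis
    using p by (auto simp: proj_set_def inf)
qed

lemma emult_diff_right: "A \<odot> (v - w) = A \<odot> v - A \<odot> w"
  by (simp add: emult_def vec_eq_iff algebra_simps)

lemma inner_emult_commute:
  fixes A :: "real ^ ('n::finite) ^ 'n"
  shows "(A \<odot> v) \<bullet> w = v \<bullet> (A \<odot> w)"
  by (simp add: inner_vec_def emult_def inner_complex_def algebra_simps)

lemma inner_emult_tuple:
  fixes A :: "component \<Rightarrow> real ^ ('n::finite) ^ 'n" and y :: "'n field6"
  shows "y \<bullet> (\<chi> c. A c \<odot> w) = (\<Sum>c\<in>UNIV. A c \<odot> y $ c) \<bullet> w"
  by (simp add: inner_vec_def[of y] inner_sum_left inner_emult_commute)

lemma sum_emult_emult:
  fixes A :: "component \<Rightarrow> real ^ ('n::finite) ^ 'n"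
  assumes "\<And>i j. (\<Sum>c\<in>UNIV. (A c $ i $ j)\<^sup>2) = r"
  shows "(\<Sum>c\<in>UNIV. A c \<odot> (A c \<odot> w)) = r *\<^sub>R w"
proof -
  have "(\<Sum>c\<in>UNIV. A c \<odot> (A c \<odot> w)) $ i $ j
      = complex_of_real (\<Sum>c\<in>UNIV. (A c $ i $ j)\<^sup>2) * w $ i $ j" for i j
    by (simp add: emult_def sum_distrib_right power2_eq_square mult.assoc)
  then show ?thesis
    unfolding assms by (simp add: vec_eq_iff scaleR_conv_of_real[where 'a=complex])
qed

text \<open>With \<open>a = k\<^sub>X\<^sup>2 / (1 + k\<^sub>Z)\<close> and \<open>b = k\<^sub>Y\<^sup>2 / (1 + k\<^sub>Z)\<close>, the four in-plane squares add up to
  \<open>2 - 2 (a + b) + (a + b)\<^sup>2\<close>. The unit condition \<open>k\<^sub>X\<^sup>2 + k\<^sub>Y\<^sup>2 = (1 - k\<^sub>Z) (1 + k\<^sub>Z)\<close> means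
  \<open>a + b = 1 - k\<^sub>Z\<close>, so they contribute \<open>1 + k\<^sub>Z\<^sup>2\<close>, and \<open>k\<^sub>X\<^sup>2 + k\<^sub>Y\<^sup>2\<close> adds \<open>1 - k\<^sub>Z\<^sup>2\<close>.\<close>

lemma sum_Emat_squares:
  fixes kX kY kZ :: "real ^ ('n::finite) ^ 'n"
  assumes unit: "(kX $ i $ j)\<^sup>2 + (kY $ i $ j)\<^sup>2 + (kZ $ i $ j)\<^sup>2 = 1"
    and nonzero: "1 + kZ $ i $ j \<noteq> 0"
  shows "(\<Sum>c\<in>UNIV. (Emat kX kY kZ c $ i $ j)\<^sup>2) = 2"
proof -
  define k l m where "k = kX $ i $ j" and "l = kY $ i $ j" and "m = kZ $ i $ j"
  define a b where "a = k\<^sup>2 / (1 + m)" and "b = l\<^sup>2 / (1 + m)"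
  have klm: "k\<^sup>2 + l\<^sup>2 = (1 - m) * (1 + m)" and m: "1 + m \<noteq> 0"
    using unit nonzero by (simp_all add: k_def l_def m_def power2_eq_square algebra_simps)
  have "a + b = (k\<^sup>2 + l\<^sup>2) / (1 + m)"
    by (simp add: a_def b_def add_divide_distrib)
  then have ab: "a + b = 1 - m"
    using klm m by simp
  have cross: "(k * l / (1 + m))\<^sup>2 = a * b"
    by (simp add: a_def b_def power2_eq_square)
  have "(\<Sum>c\<in>UNIV. (Emat kX kY kZ c $ i $ j)\<^sup>2)
      = (1 - a)\<^sup>2 + 2 * (k * l / (1 + m))\<^sup>2 + (1 - b)\<^sup>2 + (k\<^sup>2 + l\<^sup>2)"
    by (simp add: UNIV_component Emat_def a_def b_def k_def l_def m_def)
  also have "\<dots> = 2 - 2 * (a + b) + (a + b)\<^sup>2 + (k\<^sup>2 + l\<^sup>2)"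
    unfolding cross by (simp add: power2_eq_square algebra_simps)
  also have "\<dots> = 2"
    unfolding ab klm by (simp add: power2_eq_square algebra_simps)
  finally show ?thesis .
qed

theorem lemma3p5:
  fixes kX kY kZ :: "real ^ ('n::finite) ^ 'n"
    and x :: "'n field6"
  assumes unit: "\<And>i j. (kX $ i $ j)\<^sup>2 + (kY $ i $ j)\<^sup>2 + (kZ $ i $ j)\<^sup>2 = 1"
    and nonzero: "\<And>i j. 1 + kZ $ i $ j \<noteq> 0"
  shows "proj_set (Omega0 kX kY kZ) x =
    (let z = (1 / 2) *\<^sub>R (\<Sum>c\<in>UNIV. Emat kX kY kZ c \<odot> x $ c)
     in {\<chi> c. Emat kX kY kZ c \<odot> z})"
proof -
  define E where "E = Emat kX kY kZ"
  define T :: "complex ^ 'n ^ 'n \<Rightarrow> 'n field6" where "T w = (\<chi> c. E c \<odot> w)" for w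
  define z where "z = (1 / 2) *\<^sub>R (\<Sum>c\<in>UNIV. E c \<odot> x $ c)"
  have Omega0: "Omega0 kX kY kZ = range T"
    by (auto simp: Omega0_def T_def E_def)
  have T_diff: "T v - T w = T (v - w)" for v w
    by (simp add: T_def vec_eq_iff emult_diff_right)
  have TT: "(\<Sum>c\<in>UNIV. E c \<odot> (E c \<odot> z)) = 2 *\<^sub>R z"
    unfolding E_def by (intro sum_emult_emult sum_Emat_squares unit nonzero)
  have normal_equation: "(\<Sum>c\<in>UNIV. E c \<odot> (x - T z) $ c) = 0"
    using TT by (simp add: T_def emult_diff_right sum_subtractf) (simp add: z_def)
  have "orthogonal (x - T z) (T w)" for w
    using normal_equation inner_emult_tuple[of "x - T z" E w]
    by (simp add: orthogonal_def flip: T_def)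
  then have "proj_set (range T) x = {T z}"
    by (intro proj_set_eq_singleton_orthogonal) (auto simp: T_diff)
  then show ?thesis
    by (simp add: Omega0 z_def T_def E_def Let_def)
qed

end
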